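(* As formal power series in $q$, \[ (1+q^2)\sum_{n\ge0}b_2(n)q^n-(1+q)\sum_{n\ge0}a_2(n)q^n=-\frac{q^4}{1-q^3}. \]
   Context: Notation: $(x;q^2)_0=1$ and $(x;q^2)_n=\prod_{j=0}^{n-1}(1-xq^{2j})$. Let $a_2(n)$ be the number of partitions of $n$ for which there are integers $l\ge2$, $1\le k\le l-1$ such that: there are exactly $l-1$ parts equal to $1$; the smallest even part is $2k$; every part greater than $1$ lies in the interval $[2k,2l-2]$; and the odd parts greater than $1$ are distinct. Let $b_2(n)$ be defined in the same way with the interval $[2k,2l-2]$ replaced by $[2k,2l-1]$. Equivalently, \[ \sum_{n\ge0}a_2(n)q^n=\sum_{\substack{l\ge2\\1\le k\le l-1}}\frac{(-q^{2k+1};q^2)_{l-k-1}}{(q^{2k};q^2)_{l-k}}q^{2k+l-1},\qquad \sum_{n\ge0}b_2(n)q^n=\sum_{\substack{l\ge2\\1\le k\le l-1}}\frac{(-q^{2k+1};q^2)_{l-k}}{(q^{2k};q^2)_{l-k}}q^{2k+l-1}. \] *)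

theory Defs
  imports "HOL-Library.Multiset" "HOL-Computational_Algebra.Formal_Power_Series"
begin

definition partitions_of :: "nat \<Rightarrow> nat multiset set" where
  "partitions_of n = {M. 0 \<notin># M \<and> sum_mset M = n}"

definition smallest_even_part :: "nat multiset \<Rightarrow> nat \<Rightarrow> bool" where
  "smallest_even_part M e \<longleftrightarrow> e \<in># M \<and> even e \<and> (\<forall>x\<in>#M. even x \<longrightarrow> e \<le> x)"

text \<open>The truncated differences below are harmless: they are only used with \<open>l \<ge> 2\<close>.\<close>

definition admissible :: "nat \<Rightarrow> nat \<Rightarrow> nat \<Rightarrow> nat multiset \<Rightarrow> bool" where
  "admissible l k u M \<longleftrightarrow>
     count M 1 = l - 1 \<and>
     smallest_even_part M (2 * k) \<and>
     (\<forall>x\<in>#M. 1 < x \<longrightarrow> x \<in> {2 * k..u}) \<and>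
     (\<forall>x\<in>#M. odd x \<and> 1 < x \<longrightarrow> count M x = 1)"

definition a2 :: "nat \<Rightarrow> nat" where
  "a2 n = card {M \<in> partitions_of n.
                  \<exists>l k. 2 \<le> l \<and> 1 \<le> k \<and> k \<le> l - 1 \<and> admissible l k (2 * l - 2) M}"

definition b2 :: "nat \<Rightarrow> nat" where
  "b2 n = card {M \<in> partitions_of n.
                  \<exists>l k. 2 \<le> l \<and> 1 \<le> k \<and> k \<le> l - 1 \<and> admissible l k (2 * l - 1) M}"

text \<open>Finiteness, so that \<^const>\<open>card\<close> really counts in \<^const>\<open>a2\<close> and \<^const>\<open>b2\<close>.\<close>

lemma finite_partitions_of: "finite (partitions_of n)"
proof -
  have size_le: "size M \<le> sum_mset M" if "0 \<notin># M" for M :: "nat multiset"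
    using that by (induction M) auto
  have "partitions_of n \<subseteq> mset ` {xs. set xs \<subseteq> {..n} \<and> length xs \<le> n}"
  proof
    fix M assume M: "M \<in> partitions_of n"
    obtain xs where xs: "M = mset xs"
      by (metis ex_mset)
    have "set xs \<subseteq> {..n}"
      using M xs by (auto simp: partitions_of_def sum_mset_sum_list intro: member_le_sum_list)
    moreover have "length xs \<le> n"
      using size_le[of M] M xs by (simp add: partitions_of_def)
    ultimately show "M \<in> mset ` {xs. set xs \<subseteq> {..n} \<and> length xs \<le> n}"
      using xs by blast
  qed
  then show ?thesis
    by (rule finite_subset) (simp add: finite_lists_length_le)
qed

end

theory Submission
  imports Defs
begin

text \<open>
  In a partition counted by \<open>a2\<close> or \<open>b2\<close> the parameters \<open>l\<close> and \<open>k\<close> can be read off: \<open>l - 1\<close> is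
  the number \<open>c\<close> of ones and \<open>2 * k\<close> is the smallest even part. So one class of partitions
  is involved, in two versions: the parts greater than \<open>1\<close> are at most \<open>2 * c\<close> (class \<open>A\<close>) or
  at most \<open>2 * c + 1\<close> (class \<open>B\<close>). Both classes decompose according to whether the largest
  part that is allowed occurs.

  A member of \<open>B\<close> either has no part \<open>2 * c + 1\<close> and is in \<open>A\<close>, or has exactly one, and
  deleting it leaves an arbitrary member of \<open>A\<close>.

  A member of \<open>A\<close> with no part \<open>2 * c\<close> becomes, when a one is deleted, an arbitrary member of
  \<open>B\<close>: with \<open>c - 1\<close> ones, the bound \<open>2 * c - 1\<close> is that of \<open>B\<close>. If \<open>2 * c\<close> does occur, deleting
  one copy of it leaves an arbitrary member of \<open>A\<close>, except when that copy was the only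
  occurrence of the smallest even part; then the partition is \<open>1 + \<dots> + 1 + 2 * c\<close>, of
  weight \<open>3 * c\<close>.

  The members of \<open>A\<close> that receive a part \<open>2 * c + 1\<close> in the first decomposition are
  those that receive a part \<open>2 * c\<close> in the second, with total weight smaller by one.
  Eliminating them (lemmas \<open>card_ones_bounded_partitions_one\<close> and
  \<open>card_ones_bounded_partitions_zero\<close>) gives, for \<open>n > 0\<close>,
  \<open>b2 (n + 1) + b2 (n - 1) + [3 divides n] = a2 (n + 1) + a2 n\<close>,
  which is the theorem read off coefficient by coefficient.
\<close>

section \<open>Partitions whose parts are bounded by the number of ones\<close>

(* The multiplicity of the part 1 occurs throughout as \<open>count M 1\<close>; rewriting 1 to \<open>Suc 0\<close>
   would keep facts about it from matching. *)
declare One_nat_def [simp del]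

text \<open>
  The slack \<open>v\<close> is \<open>0\<close> for the partitions counted by \<open>a2\<close> and \<open>1\<close> for those counted by
  \<open>b2\<close>. That \<open>2 * k\<close> is the smallest even part follows from the lower bound on all
  parts greater than \<open>1\<close>, and \<open>k \<le> l - 1\<close> from the upper bound at the part \<open>2 * k\<close>.
\<close>

definition ones_bounded :: "nat \<Rightarrow> nat multiset \<Rightarrow> bool" where
  "ones_bounded v M \<longleftrightarrow> 0 \<notin># M \<and>
     (\<exists>k\<ge>1. 2 * k \<in># M \<and>
        (\<forall>x\<in>#M. 1 < x \<longrightarrow> 2 * k \<le> x \<and> x \<le> 2 * count M 1 + v)) \<and>
     (\<forall>x\<in>#M. odd x \<and> 1 < x \<longrightarrow> count M x = 1)"

lemma ones_bounded_mono: "ones_bounded v M \<Longrightarrow> v \<le> w \<Longrightarrow> ones_bounded w M"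
  unfolding ones_bounded_def by (meson add_left_mono order_trans)

lemma ones_bounded_iff_admissible:
  assumes "v \<le> 1"
  shows "ones_bounded v M \<longleftrightarrow> 0 \<notin># M \<and>
    (\<exists>l k. 2 \<le> l \<and> 1 \<le> k \<and> k \<le> l - 1 \<and> admissible l k (2 * l - 2 + v) M)"
    (is "_ \<longleftrightarrow> _ \<and> ?R")
proof
  assume T: "ones_bounded v M"
  then obtain k where k: "k \<ge> 1" "2 * k \<in># M"
    "\<forall>x\<in>#M. 1 < x \<longrightarrow> 2 * k \<le> x \<and> x \<le> 2 * count M 1 + v"
    by (auto simp: ones_bounded_def)
  have "2 * k \<le> 2 * count M 1 + v"
    using k by auto
  then have "k \<le> count M 1"
    using assms by linarith
  moreover have "2 * k \<le> x" if "x \<in># M" "even x" for x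
  proof -
    have "x \<noteq> 0"
      using T that unfolding ones_bounded_def by metis
    then have "1 < x"
      using \<open>even x\<close> by (cases "x = 1") auto
    then show ?thesis
      using k(3) that by auto
  qed
  ultimately have "admissible (count M 1 + 1) k (2 * (count M 1 + 1) - 2 + v) M"
    using k T by (auto simp: ones_bounded_def admissible_def smallest_even_part_def)
  moreover have "2 \<le> count M 1 + 1" "k \<le> count M 1 + 1 - 1"
    using \<open>k \<le> count M 1\<close> k(1) by linarith+
  ultimately have ?R
    using k(1) by blast
  then show "0 \<notin># M \<and> ?R"
    using T by (simp add: ones_bounded_def)
next
  assume "0 \<notin># M \<and> ?R"
  then obtain l k where lk: "0 \<notin># M" "2 \<le> l" "1 \<le> k" "admissible l k (2 * l - 2 + v) M"
    by blast
  then have "2 * count M 1 = 2 * l - 2"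
    by (auto simp: admissible_def)
  with lk show "ones_bounded v M"
    unfolding ones_bounded_def admissible_def smallest_even_part_def
    by (intro conjI exI[of _ k]) auto
qed

definition ones_bounded_partitions :: "nat \<Rightarrow> nat \<Rightarrow> nat multiset set" where
  "ones_bounded_partitions v n = {M. ones_bounded v M \<and> sum_mset M = n}"

lemma finite_ones_bounded_partitions: "finite (ones_bounded_partitions v n)"
  by (rule finite_subset[OF _ finite_partitions_of[of n]])
     (auto simp: ones_bounded_partitions_def ones_bounded_def partitions_of_def)

lemma a2_eq_card_ones_bounded_partitions: "a2 n = card (ones_bounded_partitions 0 n)"
  unfolding a2_def ones_bounded_partitions_def partitions_of_def
  by (rule arg_cong[of _ _ card]) (auto simp: ones_bounded_iff_admissible)

lemma b2_eq_card_ones_bounded_partitions: "b2 n = card (ones_bounded_partitions 1 n)"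
proof -
  have "(2 \<le> l \<and> 1 \<le> k \<and> k \<le> l - 1 \<and> admissible l k (2 * l - 1) M)
      = (2 \<le> l \<and> 1 \<le> k \<and> k \<le> l - 1 \<and> admissible l k (2 * l - 2 + 1) M)" for l k M
  proof (cases "2 \<le> l")
    case True
    then have "2 * l - 1 = 2 * l - 2 + 1"
      by simp
    then show ?thesis by simp
  qed simp
  then show ?thesis
    unfolding b2_def ones_bounded_partitions_def partitions_of_def
    by (intro arg_cong[of _ _ card])
      (auto simp only: ones_bounded_iff_admissible[OF order_refl])
qed

lemma count_one_pos_of_ones_bounded:
  assumes "ones_bounded v M" "v \<le> 1"
  shows "0 < count M 1"
proof -
  obtain k where "k \<ge> 1" "2 * k \<in># M" "2 * k \<le> 2 * count M 1 + v"
    using assms by (force simp: ones_bounded_def)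
  with assms show ?thesis
    by linarith
qed

section \<open>Adjoining the largest admissible part\<close>

definition adjoin_odd :: "nat multiset \<Rightarrow> nat multiset" where
  "adjoin_odd N = add_mset (2 * count N 1 + 1) N"

definition adjoin_even :: "nat multiset \<Rightarrow> nat multiset" where
  "adjoin_even N = add_mset (2 * count N 1) N"

text \<open>
  Since both operations keep the number of ones, the adjoined part can be recovered from
  the result; this is why they are injective. For the odd part it matters that there is
  at least one \<open>1\<close>: otherwise the adjoined part would itself be a \<open>1\<close>.
\<close>

lemma count_one_adjoin:
  "ones_bounded 0 N \<Longrightarrow> count (adjoin_odd N) 1 = count N 1"
  "count (adjoin_even N) 1 = count N 1"
proof -
  assume "ones_bounded 0 N"
  then have "0 < count N 1"
    using count_one_pos_of_ones_bounded[of 0 N] by simp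
  then show "count (adjoin_odd N) 1 = count N 1"
    by (simp add: adjoin_odd_def)
next
  have "2 * count N 1 \<noteq> 1"
    by presburger
  then show "count (adjoin_even N) 1 = count N 1"
    by (simp add: adjoin_even_def)
qed

lemma inj_on_adjoin:
  "inj_on adjoin_odd {N. ones_bounded 0 N}" "inj_on adjoin_even {N. ones_bounded 0 N}"
proof -
  show "inj_on adjoin_odd {N. ones_bounded 0 N}"
  proof (rule inj_onI)
    fix M N assume "M \<in> {N. ones_bounded 0 N}" "N \<in> {N. ones_bounded 0 N}"
      and eq: "adjoin_odd M = adjoin_odd N"
    then have "count M 1 = count N 1"
      using count_one_adjoin(1) by (metis mem_Collect_eq)
    with eq show "M = N"
      by (simp add: adjoin_odd_def)
  qed
  show "inj_on adjoin_even {N. ones_bounded 0 N}"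
  proof (rule inj_onI)
    fix M N assume eq: "adjoin_even M = adjoin_even N"
    then have "count M 1 = count N 1"
      using count_one_adjoin(2) by metis
    with eq show "M = N"
      by (simp add: adjoin_even_def)
  qed
qed

text \<open>
  The part \<open>2 * count M 1 + 1\<close> is odd and greater than \<open>1\<close>, so it occurs at most once.
  Deleting it leaves the smallest even part and the number of ones alone and brings all
  parts greater than \<open>1\<close> down to slack \<open>0\<close>.
\<close>

lemma ones_bounded_one_iff:
  "ones_bounded 1 M \<longleftrightarrow> ones_bounded 0 M \<or> (\<exists>N. ones_bounded 0 N \<and> M = adjoin_odd N)"
proof (rule iffI, rule disjCI)
  assume T: "ones_bounded 1 M" and no: "\<nexists>N. ones_bounded 0 N \<and> M = adjoin_odd N"
  define c where "c = count M 1"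
  have c: "c > 0"
    using count_one_pos_of_ones_bounded[OF T] by (simp add: c_def)
  obtain k where k: "k \<ge> 1" "2 * k \<in># M"
    "\<forall>x\<in>#M. 1 < x \<longrightarrow> 2 * k \<le> x \<and> x \<le> 2 * c + 1"
    using T by (auto simp: ones_bounded_def c_def)
  have "2 * c + 1 \<notin># M"
  proof
    assume "2 * c + 1 \<in># M"
    then obtain N where N: "M = add_mset (2 * c + 1) N"
      by (metis insert_DiffM)
    have cN: "count N 1 = c"
      using c_def c by (simp add: N)
    have "count M (2 * c + 1) = 1"
      using T c \<open>2 * c + 1 \<in># M\<close> by (auto simp: ones_bounded_def)
    then have fresh: "2 * c + 1 \<notin># N"
      by (simp add: N not_in_iff)
    have bd: "2 * k \<le> x \<and> x \<le> 2 * c" if "x \<in># N" "1 < x" for x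
    proof -
      have "x \<noteq> 2 * c + 1"
        using fresh that by blast
      moreover have "2 * k \<le> x \<and> x \<le> 2 * c + 1"
        using k(3) that by (simp add: N)
      ultimately show ?thesis by linarith
    qed
    have "2 * k \<in># N"
      using k(2) unfolding N by (auto, presburger)
    moreover have "count N x = 1" if "x \<in># N" "odd x" "1 < x" for x
      using T that fresh by (auto simp: ones_bounded_def N split: if_splits)
    moreover have "0 \<notin># N"
      using T by (simp add: ones_bounded_def N)
    ultimately have "ones_bounded 0 N"
      using bd k(1) by (auto simp: ones_bounded_def cN[simplified])
    with no show False
      using N cN by (auto simp: adjoin_odd_def)
  qed
  then have "x \<le> 2 * c" if "x \<in># M" "1 < x" for x
    using k(3) that by (metis Suc_eq_plus1 le_SucE)
  then show "ones_bounded 0 M"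
    using T k by (auto simp: ones_bounded_def c_def)
next
  assume "ones_bounded 0 M \<or> (\<exists>N. ones_bounded 0 N \<and> M = adjoin_odd N)"
  then show "ones_bounded 1 M"
  proof (elim disjE exE conjE)
    show "ones_bounded 0 M \<Longrightarrow> ones_bounded 1 M"
      by (erule ones_bounded_mono) simp
  next
    fix N assume T: "ones_bounded 0 N" and M: "M = adjoin_odd N"
    have cM: "count M 1 = count N 1"
      using count_one_adjoin(1)[OF T] by (simp add: M)
    obtain k where k: "k \<ge> 1" "2 * k \<in># N"
      "\<forall>x\<in>#N. 1 < x \<longrightarrow> 2 * k \<le> x \<and> x \<le> 2 * count N 1"
      using T by (auto simp: ones_bounded_def)
    have "2 * k \<le> 2 * count N 1"
      using k by auto
    then have bd: "2 * k \<le> x \<and> x \<le> 2 * count N 1 + 1" if "x \<in># M" "1 < x" for x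
      using that k(3) by (force simp: M adjoin_odd_def)
    have fresh: "2 * count N 1 + 1 \<notin># N"
      using k(3) count_one_pos_of_ones_bounded[OF T] by force
    have "count M x = 1" if "x \<in># M" "odd x" "1 < x" for x
      using T that fresh by (auto simp: ones_bounded_def M adjoin_odd_def not_in_iff)
    moreover have "0 \<notin># M" "2 * k \<in># M"
      using T k(2) by (simp_all add: ones_bounded_def M adjoin_odd_def)
    ultimately show "ones_bounded 1 M"
      using bd k(1) cM by (auto simp: ones_bounded_def)
  qed
qed

lemma not_ones_bounded_adjoin_odd: "ones_bounded 0 N \<Longrightarrow> \<not> ones_bounded 0 (adjoin_odd N)"
  using count_one_adjoin(1)[of N] count_one_pos_of_ones_bounded[of 0 N]
  by (auto simp: ones_bounded_def adjoin_odd_def)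

definition lone_even :: "nat \<Rightarrow> nat multiset" where
  "lone_even k = add_mset (2 * k) (replicate_mset k 1)"

text \<open>One more \<open>1\<close> raises the bound \<open>2 * count N 1\<close> by two, which absorbs the slack.\<close>

lemma ones_bounded_add_one:
  assumes "ones_bounded 1 N"
  shows "ones_bounded 0 (add_mset 1 N)"
proof -
  obtain k where k: "k \<ge> 1" "2 * k \<in># N"
    "\<forall>x\<in>#N. 1 < x \<longrightarrow> 2 * k \<le> x \<and> x \<le> 2 * count N 1 + 1"
    using assms by (auto simp: ones_bounded_def)
  have "2 * k \<le> x \<and> x \<le> 2 * count (add_mset 1 N) 1 + 0"
    if "x \<in># add_mset 1 N" "1 < x" for x
    using k(3) that by force
  moreover have "count (add_mset 1 N) x = 1" if "x \<in># add_mset 1 N" "odd x" "1 < x" for x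
    using assms that by (auto simp: ones_bounded_def)
  moreover have "0 \<notin># add_mset 1 N" "2 * k \<in># add_mset 1 N"
    using assms k(2) by (simp_all add: ones_bounded_def)
  ultimately show ?thesis
    using k(1) unfolding ones_bounded_def by blast
qed

lemma ones_bounded_adjoin_even:
  assumes T: "ones_bounded 0 N"
  shows "ones_bounded 0 (adjoin_even N)"
proof -
  obtain k where k: "k \<ge> 1" "2 * k \<in># N"
    "\<forall>x\<in>#N. 1 < x \<longrightarrow> 2 * k \<le> x \<and> x \<le> 2 * count N 1"
    using T by (auto simp: ones_bounded_def)
  moreover have "2 * k \<le> 2 * count N 1"
    using k by auto
  moreover have "count (adjoin_even N) x = 1" if "x \<in># N" "odd x" "1 < x" for x
    using T that by (auto simp: ones_bounded_def adjoin_even_def)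
  moreover have "0 \<notin># adjoin_even N"
    using T count_one_pos_of_ones_bounded[OF T] by (simp add: ones_bounded_def adjoin_even_def)
  ultimately show ?thesis
    unfolding ones_bounded_def count_one_adjoin(2)
    by (intro conjI exI[of _ k]) (auto simp: adjoin_even_def)
qed

lemma ones_bounded_lone_even:
  assumes "k \<ge> 1"
  shows "ones_bounded 0 (lone_even k)"
  unfolding ones_bounded_def using assms
  by (intro conjI exI[of _ k]) (auto simp: lone_even_def)

text \<open>
  With \<open>c\<close> the number of ones of \<open>M\<close> and \<open>2 * k\<close> its smallest even part, the cases arise as
  follows: the part \<open>2 * c\<close> does not occur; or a copy of it can be deleted and \<open>2 * k\<close> still
  occurs; or it is the only copy of \<open>2 * k\<close>. In the last case \<open>k = c\<close>, so every part greater
  than \<open>1\<close> equals \<open>2 * c\<close>, and there is only one.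
\<close>

lemma ones_bounded_zero_cases:
  assumes T: "ones_bounded 0 M"
  shows "(\<exists>N. ones_bounded 1 N \<and> M = add_mset 1 N) \<or> (\<exists>N. ones_bounded 0 N \<and> M = adjoin_even N)
    \<or> (\<exists>k\<ge>1. M = lone_even k)"
proof -
  define c where "c = count M 1"
  have c: "c > 0"
    using count_one_pos_of_ones_bounded[OF T] by (simp add: c_def)
  obtain k where k: "k \<ge> 1" "2 * k \<in># M"
    "\<forall>x\<in>#M. 1 < x \<longrightarrow> 2 * k \<le> x \<and> x \<le> 2 * c"
    using T by (auto simp: ones_bounded_def c_def)
  have zero: "0 \<notin># M"
    and dist: "\<And>x. x \<in># M \<Longrightarrow> odd x \<Longrightarrow> 1 < x \<Longrightarrow> count M x = 1"
    using T by (auto simp: ones_bounded_def)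
  show ?thesis
  proof (cases "2 * c \<in># M")
    case False
    obtain N where N: "M = add_mset 1 N"
      using c by (metis c_def count_greater_zero_iff insert_DiffM)
    have cN: "c = count N 1 + 1"
      by (simp add: c_def N)
    have "2 * k \<le> x \<and> x \<le> 2 * count N 1 + 1" if "x \<in># N" "1 < x" for x
    proof -
      have "x \<noteq> 2 * c"
        using that False by (auto simp: N)
      moreover have "2 * k \<le> x \<and> x \<le> 2 * c"
        using k(3) that by (simp add: N)
      ultimately show ?thesis
        using cN by linarith
    qed
    moreover have "2 * k \<in># N"
      using k(2) by (auto simp: N)
    moreover have "count N x = 1" if "x \<in># N" "odd x" "1 < x" for x
      using dist[of x] that by (simp add: N)
    ultimately have "ones_bounded 1 N"
      using zero k(1) by (auto simp: ones_bounded_def N)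
    with N show ?thesis by blast
  next
    case True
    then obtain N where N: "M = add_mset (2 * c) N"
      by (metis insert_DiffM)
    have cN: "count N 1 = c"
      unfolding c_def by (subst N) (use c in simp)
    show ?thesis
    proof (cases "2 * k \<in># N")
      case True
      have "count N x = 1" if "x \<in># N" "odd x" "1 < x" for x
        using dist[of x] that by (auto simp: N split: if_splits)
      then have "ones_bounded 0 N"
        using zero k True cN by (auto simp: ones_bounded_def N)
      with N cN show ?thesis
        by (auto simp: adjoin_even_def)
    next
      case False
      then have kc: "k = c"
        using k(2) by (auto simp: N)
      have "x = 1" if "x \<in># N" for x
      proof (rule ccontr)
        assume "x \<noteq> 1"
        moreover have "x \<noteq> 0"
          using that zero unfolding N by (metis union_iff add_mset_add_single)
        ultimately have "x = 2 * c"
          using k(3) that kc by (force simp: N)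
        with False that kc show False by simp
      qed
      then have "set_mset N \<subseteq> {1}"
        by blast
      then have "N = replicate_mset c 1"
        using cN by (metis set_mset_subset_singletonD count_replicate_mset)
      with N kc k(1) show ?thesis
        by (auto simp: lone_even_def)
    qed
  qed
qed

text \<open>
  The three cases exclude each other. In the last two the part \<open>2 * c\<close> occurs, with \<open>c\<close> the
  number of ones of the whole partition, whereas in the first the parts greater than \<open>1\<close> are
  at most \<open>2 * c - 1\<close>. What remains after deleting one \<open>2 * c\<close> has an even part in the second
  case and none in the third.
\<close>

lemma ones_bounded_add_one_ne_adjoin_even:
  assumes "ones_bounded 1 N"
  shows "add_mset 1 N \<noteq> adjoin_even N'"
proof
  assume eq: "add_mset 1 N = adjoin_even N'"
  then have "count N' 1 = count N 1 + 1"
    by (metis count_one_adjoin(2) count_add_mset Suc_eq_plus1)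
  then have "2 * count N 1 + 2 \<in># add_mset 1 N"
    using eq by (simp add: adjoin_even_def)
  then show False
    using assms by (fastforce simp: ones_bounded_def)
qed

lemma ones_bounded_add_one_ne_lone_even:
  assumes "ones_bounded 1 N"
  shows "add_mset 1 N \<noteq> lone_even k"
proof
  assume eq: "add_mset 1 N = lone_even k"
  have "count (lone_even k) 1 = k"
    by (simp add: lone_even_def)
  then have "k = count N 1 + 1"
    by (simp add: eq[symmetric])
  then have "2 * count N 1 + 2 \<in># add_mset 1 N"
    using eq by (simp add: lone_even_def)
  then show False
    using assms by (fastforce simp: ones_bounded_def)
qed

lemma ones_bounded_adjoin_even_ne_lone_even:
  assumes "ones_bounded 0 N"
  shows "adjoin_even N \<noteq> lone_even k"
proof
  assume eq: "adjoin_even N = lone_even k"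
  have "count (lone_even k) 1 = k"
    by (simp add: lone_even_def)
  then have "k = count N 1"
    by (metis count_one_adjoin(2) eq)
  with eq have "N = replicate_mset k 1"
    by (simp add: adjoin_even_def lone_even_def)
  with assms show False
    by (auto simp: ones_bounded_def)
qed

section \<open>Counting\<close>

lemma sum_lone_even: "sum_mset (lone_even k) = 3 * k"
  by (simp add: lone_even_def)

lemma card_lone_evens:
  "card {M. \<exists>k\<ge>1. M = lone_even k \<and> sum_mset M = n} = of_bool (n > 0 \<and> 3 dvd n)"
proof (cases "n > 0 \<and> 3 dvd n")
  case True
  then have "{M. \<exists>k\<ge>1. M = lone_even k \<and> sum_mset M = n} = {lone_even (n div 3)}"
    by (auto simp: sum_lone_even intro!: exI[of _ "n div 3"])
  with True show ?thesis by simp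
next
  case False
  then have "{M. \<exists>k\<ge>1. M = lone_even k \<and> sum_mset M = n} = {}"
    by (auto simp: sum_lone_even)
  with False show ?thesis
    by (simp only: card.empty) simp
qed

text \<open>
  The weight condition says that \<open>adjoin_even N\<close> has weight \<open>n\<close>, and equally that
  \<open>adjoin_odd N\<close> has weight \<open>n + 1\<close>. This common source is what links the two counts.
\<close>

definition adjoin_sources :: "nat \<Rightarrow> nat multiset set" where
  "adjoin_sources n = {N. ones_bounded 0 N \<and> sum_mset N + 2 * count N 1 = n}"

lemma finite_adjoin_sources: "finite (adjoin_sources n)"
proof (rule finite_subset)
  show "adjoin_sources n \<subseteq> (\<Union>m\<le>n. ones_bounded_partitions 0 m)"
    by (auto simp: adjoin_sources_def ones_bounded_partitions_def)
  show "finite (\<Union>m\<le>n. ones_bounded_partitions 0 m)"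
    by (simp add: finite_ones_bounded_partitions)
qed

lemma card_ones_bounded_partitions_one:
  "card (ones_bounded_partitions 1 (Suc n)) =
     card (ones_bounded_partitions 0 (Suc n)) + card (adjoin_sources n)"
proof -
  have "ones_bounded_partitions 1 (Suc n) =
      ones_bounded_partitions 0 (Suc n) \<union> adjoin_odd ` adjoin_sources n"
    by (auto simp: ones_bounded_partitions_def adjoin_sources_def ones_bounded_one_iff
        adjoin_odd_def)
  moreover have "ones_bounded_partitions 0 (Suc n) \<inter> adjoin_odd ` adjoin_sources n = {}"
    using not_ones_bounded_adjoin_odd by (auto simp: ones_bounded_partitions_def adjoin_sources_def)
  moreover have "card (adjoin_odd ` adjoin_sources n) = card (adjoin_sources n)"
    by (rule card_image, rule inj_on_subset[OF inj_on_adjoin(1)]) (auto simp: adjoin_sources_def)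
  ultimately show ?thesis
    by (simp add: card_Un_disjoint finite_ones_bounded_partitions finite_adjoin_sources)
qed

lemma card_ones_bounded_partitions_zero:
  "card (ones_bounded_partitions 0 n) =
     (if n = 0 then 0 else card (ones_bounded_partitions 1 (n - 1))) + card (adjoin_sources n)
     + of_bool (n > 0 \<and> 3 dvd n)"
proof -
  define P where "P = {N. ones_bounded 1 N \<and> Suc (sum_mset N) = n}"
  define S where "S = {M. \<exists>k\<ge>1. M = lone_even k \<and> sum_mset M = n}"
  have P: "P = (if n = 0 then {} else ones_bounded_partitions 1 (n - 1))"
    by (auto simp: P_def ones_bounded_partitions_def)
  have split: "ones_bounded_partitions 0 n =
      (add_mset 1 ` P \<union> adjoin_even ` adjoin_sources n) \<union> S"
  proof (intro equalityI subsetI)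
    fix M assume "M \<in> ones_bounded_partitions 0 n"
    then have "ones_bounded 0 M" "sum_mset M = n"
      by (auto simp: ones_bounded_partitions_def)
    with ones_bounded_zero_cases[of M]
    show "M \<in> (add_mset 1 ` P \<union> adjoin_even ` adjoin_sources n) \<union> S"
      by (auto simp: P_def adjoin_sources_def S_def adjoin_even_def)
  next
    fix M assume "M \<in> (add_mset 1 ` P \<union> adjoin_even ` adjoin_sources n) \<union> S"
    then show "M \<in> ones_bounded_partitions 0 n"
      using ones_bounded_add_one ones_bounded_adjoin_even ones_bounded_lone_even
      by (auto simp: P_def adjoin_sources_def S_def ones_bounded_partitions_def)
        (auto simp: adjoin_even_def)
  qed
  have fin: "finite (add_mset 1 ` P)" "finite (adjoin_even ` adjoin_sources n)" "finite S"
    using finite_ones_bounded_partitions[of 0 n] by (simp_all add: split)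
  have "add_mset 1 ` P \<inter> adjoin_even ` adjoin_sources n = {}"
    using ones_bounded_add_one_ne_adjoin_even by (auto simp: P_def)
  moreover have "(add_mset 1 ` P \<union> adjoin_even ` adjoin_sources n) \<inter> S = {}"
    unfolding P_def S_def adjoin_sources_def
    using ones_bounded_add_one_ne_lone_even ones_bounded_adjoin_even_ne_lone_even by blast
  moreover have "card (add_mset 1 ` P) = card P"
    by (rule card_image) (auto intro: inj_onI)
  moreover have "card (adjoin_even ` adjoin_sources n) = card (adjoin_sources n)"
    by (rule card_image, rule inj_on_subset[OF inj_on_adjoin(2)]) (auto simp: adjoin_sources_def)
  ultimately have "card (ones_bounded_partitions 0 n) = card P + card (adjoin_sources n) + card S"
    unfolding split using fin by (simp add: card_Un_disjoint)
  then show ?thesis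
    by (simp add: P S_def card_lone_evens[simplified])
qed

lemma b2_a2_recurrence:
  "b2 (Suc n) + (if n = 0 then 0 else b2 (n - 1)) + of_bool (n > 0 \<and> 3 dvd n) = a2 (Suc n) + a2 n"
  using card_ones_bounded_partitions_one[of n] card_ones_bounded_partitions_zero[of n]
  by (simp add: a2_eq_card_ones_bounded_partitions b2_eq_card_ones_bounded_partitions)

lemma b2_a2_zero: "b2 0 = 0" "a2 0 = 0"
proof -
  have "ones_bounded_partitions v 0 = {}" if "v \<le> 1" for v
    using count_one_pos_of_ones_bounded[OF _ that] by (force simp: ones_bounded_partitions_def)
  then show "b2 0 = 0" "a2 0 = 0"
    by (simp_all add: b2_eq_card_ones_bounded_partitions a2_eq_card_ones_bounded_partitions)
qed

section \<open>The generating function identity\<close>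

lemma fps_X4_over_one_minus_X3:
  "(fps_X ^ 4 / (1 - fps_X ^ 3) :: rat fps) = Abs_fps (\<lambda>n. of_bool (n > 1 \<and> 3 dvd (n - 1)))"
    (is "_ = ?G")
proof -
  have "?G * (1 - fps_X ^ 3) = fps_X ^ 4"
  proof (rule fps_ext)
    fix n :: nat
    have "n < 3 \<or> n = 3 \<or> n = 4 \<or> n > 4"
      by linarith
    then show "fps_nth (?G * (1 - fps_X ^ 3)) n = fps_nth (fps_X ^ 4) n"
    proof (elim disjE)
      assume "n > 4"
      then have "3 dvd (n - 1) \<longleftrightarrow> 3 dvd (n - 4)"
        by presburger
      with \<open>n > 4\<close> show ?thesis
        by (simp add: right_diff_distrib fps_X_power_mult_right_nth fps_X_power_nth)
    qed (auto simp: right_diff_distrib fps_X_power_mult_right_nth fps_X_power_nth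
          dest: dvd_imp_le)
  qed
  moreover have "(1 - fps_X ^ 3 :: rat fps) \<noteq> 0"
  proof
    assume "(1 - fps_X ^ 3 :: rat fps) = 0"
    then have "fps_nth (1 - fps_X ^ 3 :: rat fps) 0 = 0" by simp
    then show False by simp
  qed
  ultimately show ?thesis
    by (metis nonzero_mult_div_cancel_right)
qed

theorem corollary2:
  "(1 + fps_X ^ 2) * Abs_fps (\<lambda>n. of_nat (b2 n))
     - (1 + fps_X) * Abs_fps (\<lambda>n. of_nat (a2 n))
   = - (fps_X ^ 4 / (1 - fps_X ^ 3) :: rat fps)"
proof (rule fps_ext)
  fix n
  show "fps_nth ((1 + fps_X ^ 2) * Abs_fps (\<lambda>n. of_nat (b2 n))
     - (1 + fps_X) * Abs_fps (\<lambda>n. of_nat (a2 n))) n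
   = fps_nth (- (fps_X ^ 4 / (1 - fps_X ^ 3) :: rat fps)) n"
  proof (cases n)
    case 0
    then show ?thesis
      by (simp add: fps_X4_over_one_minus_X3 b2_a2_zero)
  next
    case (Suc m)
    have "(of_nat (b2 (Suc m)) + (if m = 0 then 0 else of_nat (b2 (m - 1)))
        + of_bool (m > 0 \<and> 3 dvd m) :: rat) = of_nat (a2 (Suc m)) + of_nat (a2 m)"
      using arg_cong[OF b2_a2_recurrence[of m], of "of_nat :: nat \<Rightarrow> rat"]
      by (cases "m = 0"; cases "3 dvd m") simp_all
    moreover have "fps_nth (fps_X ^ 4 / (1 - fps_X ^ 3) :: rat fps) n = of_bool (m > 0 \<and> 3 dvd m)"
      by (simp add: fps_X4_over_one_minus_X3 Suc)
    ultimately show ?thesis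
      by (cases "m = 0"; cases "3 dvd m")
        (simp_all add: Suc distrib_right fps_X_power_mult_nth b2_a2_zero)
  qed
qed

end
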